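(* Let $X\subseteq\mathbb C^n$ be an irreducible curve. (I) If $X$ is not contained in any hypersphere, then $\Sigma_X^\infty=\emptyset$. (II) Otherwise, let $c$ be the center of a hypersphere containing $X$, let $V$ be the smallest affine linear subspace of $\mathbb C^n$ containing $X$, and let $N\,V=\{y\in\mathbb C^n: y\cdot(v-v')=0\ \forall v,v'\in V\}$ be its normal space. Then $\Sigma_X^\infty=\{c+y:y\in N\,V\}$.
   Context: For $x,y\in\mathbb C^n$, $x\cdot y=\sum x_iy_i$ (complex bilinear). A hypersphere centered at $c$ is a set $\{x:(x-c)\cdot(x-c)=r\}$ for some $r\in\mathbb C$ ($r=0$ allowed). For $x\in X_{\mathrm{reg}}$ (smooth locus), $N_xX$ is the span of gradients at $x$ of generators of the ideal of $X$. The ED correspondence $\mathcal E_X$ is the Zariski closure of $\{(x,u):x\in X_{\mathrm{reg}},u-x\in N_xX\}$, $\mathcal E_X(u)=\{x:(x,u)\in\mathcal E_X\}$, and $\Sigma_X^\infty=\{u:\dim\mathcal E_X(u)\ge1\}$. *)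

theory Defs
  imports "HOL-Analysis.Analysis"
begin

text \<open>Polynomial functions on a space with a given set of coordinate functions C:
  the smallest set containing constants and coordinates, closed under + and *.
  Over the infinite field of complex numbers these are exactly the polynomials.\<close>

inductive_set polyfun :: "('a \<Rightarrow> complex) set \<Rightarrow> ('a \<Rightarrow> complex) set"
  for C :: "('a \<Rightarrow> complex) set" where
  pf_const: "(\<lambda>x. c) \<in> polyfun C"
| pf_coord: "f \<in> C \<Longrightarrow> f \<in> polyfun C"
| pf_add: "f \<in> polyfun C \<Longrightarrow> g \<in> polyfun C \<Longrightarrow> (\<lambda>x. f x + g x) \<in> polyfun C"
| pf_mult: "f \<in> polyfun C \<Longrightarrow> g \<in> polyfun C \<Longrightarrow> (\<lambda>x. f x * g x) \<in> polyfun C"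

definition coordsV :: "(complex^'n \<Rightarrow> complex) set" where
  "coordsV = range (\<lambda>i x. x $ i)"

definition coordsP :: "((complex^'n) \<times> (complex^'n) \<Rightarrow> complex) set" where
  "coordsP = range (\<lambda>i p. fst p $ i) \<union> range (\<lambda>i p. snd p $ i)"

definition zero_set :: "('a \<Rightarrow> complex) set \<Rightarrow> 'a set" where
  "zero_set F = {x. \<forall>f\<in>F. f x = 0}"

definition zariski_closed :: "('a \<Rightarrow> complex) set \<Rightarrow> 'a set \<Rightarrow> bool" where
  "zariski_closed C S \<longleftrightarrow> (\<exists>F. F \<subseteq> polyfun C \<and> S = zero_set F)"

definition zariski_closure :: "('a \<Rightarrow> complex) set \<Rightarrow> 'a set \<Rightarrow> 'a set" where
  "zariski_closure C S = \<Inter>{Z. zariski_closed C Z \<and> S \<subseteq> Z}"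

definition vanishing_ideal :: "('a \<Rightarrow> complex) set \<Rightarrow> 'a set \<Rightarrow> ('a \<Rightarrow> complex) set" where
  "vanishing_ideal C S = {f \<in> polyfun C. \<forall>x\<in>S. f x = 0}"

definition zariski_irreducible :: "('a \<Rightarrow> complex) set \<Rightarrow> 'a set \<Rightarrow> bool" where
  "zariski_irreducible C S \<longleftrightarrow> zariski_closed C S \<and> S \<noteq> {} \<and>
     (\<forall>A B. zariski_closed C A \<and> zariski_closed C B \<and> S = A \<union> B \<longrightarrow> S = A \<or> S = B)"

definition dim_ge :: "('a \<Rightarrow> complex) set \<Rightarrow> 'a set \<Rightarrow> nat \<Rightarrow> bool" where
  "dim_ge C S k \<longleftrightarrow> (\<exists>Z :: nat \<Rightarrow> 'a set.
      (\<forall>i\<le>k. zariski_irreducible C (Z i) \<and> Z i \<subseteq> S) \<and> (\<forall>i<k. Z i \<subset> Z (Suc i)))"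

definition alg_dim :: "('a \<Rightarrow> complex) set \<Rightarrow> 'a set \<Rightarrow> nat" where
  "alg_dim C S = (GREATEST k. dim_ge C S k)"

definition irreducible_curve :: "(complex^'n) set \<Rightarrow> bool" where
  "irreducible_curve X \<longleftrightarrow> zariski_irreducible coordsV X \<and> dim_ge coordsV X 1 \<and> \<not> dim_ge coordsV X 2"

definition partial_deriv :: "(complex^'n \<Rightarrow> complex) \<Rightarrow> 'n \<Rightarrow> complex^'n \<Rightarrow> complex" where
  "partial_deriv f i x = deriv (\<lambda>t. f (x + (\<chi> j. if j = i then t else 0))) 0"

definition gradient :: "(complex^'n \<Rightarrow> complex) \<Rightarrow> complex^'n \<Rightarrow> complex^'n" where
  "gradient f x = (\<chi> i. partial_deriv f i x)"

text \<open>N_x X: complex span of the gradients at x of the elements of the ideal of X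
  (equal, for x in X, to the span of the gradients of any generating set).\<close>
definition normal_space_at :: "(complex^'n) set \<Rightarrow> complex^'n \<Rightarrow> (complex^'n) set" where
  "normal_space_at X x = vec.span ((\<lambda>f. gradient f x) ` vanishing_ideal coordsV X)"

text \<open>Smooth locus (Jacobian criterion): points where dim N_x X = n - dim X.\<close>
definition regular_points :: "(complex^'n) set \<Rightarrow> (complex^'n) set" where
  "regular_points X = {x \<in> X. vec.dim (normal_space_at X x) = CARD('n) - alg_dim coordsV X}"

definition ED_corr :: "(complex^'n) set \<Rightarrow> ((complex^'n) \<times> (complex^'n)) set" where
  "ED_corr X = zariski_closure coordsP
     {(x, u). x \<in> regular_points X \<and> u - x \<in> normal_space_at X x}"

definition ED_fiber :: "(complex^'n) set \<Rightarrow> complex^'n \<Rightarrow> (complex^'n) set" where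
  "ED_fiber X u = {x. (x, u) \<in> ED_corr X}"

definition Sigma_inf :: "(complex^'n) set \<Rightarrow> (complex^'n) set" where
  "Sigma_inf X = {u. dim_ge coordsV (ED_fiber X u) 1}"

definition bdot :: "complex^'n \<Rightarrow> complex^'n \<Rightarrow> complex" where
  "bdot x y = (\<Sum>i\<in>UNIV. x $ i * y $ i)"

definition hypersphere :: "complex^'n \<Rightarrow> complex \<Rightarrow> (complex^'n) set" where
  "hypersphere c r = {x. bdot (x - c) (x - c) = r}"

definition complex_affine :: "(complex^'n) set \<Rightarrow> bool" where
  "complex_affine V \<longleftrightarrow> V = {} \<or> (\<exists>p W. vec.subspace W \<and> V = (\<lambda>w. p + w) ` W)"

definition complex_affine_hull :: "(complex^'n) set \<Rightarrow> (complex^'n) set" where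
  "complex_affine_hull X = \<Inter>{V. complex_affine V \<and> X \<subseteq> V}"

definition normal_space_affine :: "(complex^'n) set \<Rightarrow> (complex^'n) set" where
  "normal_space_affine V = {y. \<forall>v\<in>V. \<forall>v'\<in>V. bdot y (v - v') = 0}"

end

theory Submission
  imports Defs "HOL-Complex_Analysis.Conformal_Mappings"
begin

text \<open>
  At a point \<open>x0\<close> where the normal space of \<open>X\<close> has maximal dimension, choose polynomials in the
  ideal whose gradients form a basis of it, and complete them by linear forms to local coordinates.
  The coordinate fields of the linear forms, cleared of denominators, are polynomial fields
  orthogonal to all normal spaces of \<open>X\<close>, so differentiation along them preserves the ideal of \<open>X\<close>.
  Hence every element of the ideal vanishes to infinite order along the holomorphic coordinate
  arcs through \<open>x0\<close>, and these arcs lie in \<open>X\<close>. The Zariski closure of an arc is irreducible, hence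
  all of \<open>X\<close>. A second linear form would be constant along the arc of the first, hence on \<open>X\<close>, but
  not along its own arc; so exactly one is needed, and a single arc of regular points is dense.

  If \<open>u \<in> Sigma_inf X\<close>, then \<open>ED_fiber X u = X\<close>, and \<open>u - x\<close> is orthogonal to the tangent field
  at every \<open>x \<in> X\<close>; thus the squared distance to \<open>u\<close> is constant along the arc, hence on \<open>X\<close>.
  Conversely, if \<open>u\<close> is a center, \<open>u - x\<close> is normal at every \<open>x \<in> X\<close>. So \<open>Sigma_inf X\<close> is the
  set of centers of hyperspheres containing \<open>X\<close>.
\<close>

section \<open>Matrices and the complex dot product\<close>

lemma matrix_inv_vector_mult:
  fixes A :: "'a::field^'n^'n"
  assumes "det A \<noteq> 0"
  shows "A *v (matrix_inv A *v b) = b" and "matrix_inv A *v (A *v b) = b"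
proof -
  have "A ** matrix_inv A = mat 1 \<and> matrix_inv A ** A = mat 1"
    using assms unfolding invertible_det_nz[symmetric] invertible_def matrix_inv_def
    by (rule someI_ex)
  then show "A *v (matrix_inv A *v b) = b" and "matrix_inv A *v (A *v b) = b"
    by (simp_all add: matrix_vector_mul_assoc)
qed

lemma rows_eq_range: "rows A = range (($) A)"
  by (auto simp: rows_def row_def)

lemma inj_rows_if_det_nz:
  fixes A :: "'a::comm_ring_1^'n^'n"
  assumes "det A \<noteq> 0"
  shows "inj (($) A)"
proof (rule injI)
  fix i j assume "A $ i = A $ j"
  then show "i = j"
    using assms det_identical_rows[of i j A] by (auto simp: row_def)
qed

lemma independent_rows_if_det_nz:
  fixes A :: "'a::field^'n^'n"
  assumes "det A \<noteq> 0"
  shows "vec.independent (range (($) A))"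
  using assms det_dependent_rows[of A] by (auto simp: rows_eq_range)

lemma extend_independent_to_nonsingular_matrix:
  fixes B :: "('a::field^'n) set"
  assumes "vec.independent B"
  obtains A :: "'a^'n^'n" and J where "det A \<noteq> 0" "bij_betw (($) A) J B"
proof -
  obtain B' where B': "B \<subseteq> B'" "vec.independent B'" "UNIV \<subseteq> vec.span B'"
    using vec.maximal_independent_subset_extend[OF subset_UNIV assms] by metis
  have "card B' = CARD('n)"
    using vec.dim_unique[OF subset_UNIV B'(3,2) refl] unfolding vec_dim_card by simp
  then obtain \<beta> where \<beta>: "bij_betw \<beta> (UNIV :: 'n set) B'"
    using finite_same_card_bij[of "UNIV :: 'n set" B'] vec.finiteI_independent[OF B'(2)] by auto
  define A where "A = (\<chi> i. \<beta> i)"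
  have A: "($) A = \<beta>" by (simp add: A_def fun_eq_iff)
  have "vec.span (rows A) = UNIV"
    using \<beta> B'(3) by (auto simp: rows_eq_range A bij_betw_def)
  then have "det A \<noteq> 0"
    by (simp add: invertible_det_nz[symmetric] invertible_left_inverse
        matrix_left_invertible_span_rows_gen)
  moreover have "bij_betw (($) A) {i. \<beta> i \<in> B} B"
    using \<beta> B'(1) by (auto simp: A bij_betw_def inj_on_def)
  ultimately show thesis by (rule that)
qed

lemma bounded_bilinear_bdot: "bounded_bilinear bdot"
proof
  show "\<exists>K. \<forall>x y :: complex^'n. norm (bdot x y) \<le> norm x * norm y * K"
  proof (intro exI allI)
    fix x y :: "complex^'n"
    have "norm (bdot x y) \<le> (\<Sum>i\<in>UNIV. norm (x $ i) * norm (y $ i))"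
      unfolding bdot_def norm_mult[symmetric] by (rule norm_sum)
    also have "\<dots> \<le> (\<Sum>i\<in>(UNIV :: 'n set). norm x * norm y)"
      by (intro sum_mono mult_mono Finite_Cartesian_Product.norm_nth_le) auto
    finally show "norm (bdot x y) \<le> norm x * norm y * CARD('n)"
      by (simp add: mult.commute)
  qed
qed (simp_all add: bdot_def ring_distribs sum.distrib scaleR_sum_right)

interpretation bdot: bounded_bilinear bdot
  by (rule bounded_bilinear_bdot)

lemma bdot_commute: "bdot x y = bdot y x"
  by (simp add: bdot_def mult.commute)

lemma bdot_scale_left: "bdot (c *s x) y = c * bdot x y"
  by (simp add: bdot_def sum_distrib_left mult.assoc)

lemma bdot_scale_right: "bdot x (c *s y) = c * bdot x y"
  by (simp add: bdot_def sum_distrib_left mult_ac)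

lemma bdot_axis_right: "bdot x (axis i 1) = x $ i"
  by (simp add: bdot_def axis_def if_distrib cong: if_cong)

lemma matrix_vector_mult_component_bdot: "(A *v x) $ i = bdot (A $ i) x"
  by (simp add: matrix_vector_mult_def bdot_def)

lemma subspace_bdot_kernel: "vec.subspace {x. bdot w x = 0}"
  by (simp add: vec.subspace_def bdot.zero_right bdot.add_right bdot_scale_right)

lemma bdot_span_eq_0:
  assumes "y \<in> vec.span S" "\<And>s. s \<in> S \<Longrightarrow> bdot w s = 0"
  shows "bdot w y = 0"
  using vec.span_minimal[OF _ subspace_bdot_kernel, of S w] assms by auto

section \<open>Polynomial functions and their derivatives\<close>

definition polymap :: "('a \<Rightarrow> complex) set \<Rightarrow> ('a \<Rightarrow> complex^'n) set" where
  "polymap C = {v. \<forall>i. (\<lambda>x. v x $ i) \<in> polyfun C}"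

lemma polyfun_diff:
  assumes "f \<in> polyfun C" "g \<in> polyfun C"
  shows "(\<lambda>x. f x - g x) \<in> polyfun C"
  using pf_add[OF assms(1) pf_mult[OF pf_const[of "- 1"] assms(2)]] by simp

lemma polyfun_sum:
  assumes "\<And>i. i \<in> S \<Longrightarrow> f i \<in> polyfun C"
  shows "(\<lambda>x. \<Sum>i\<in>S. f i x) \<in> polyfun C"
  using assms by (induction S rule: infinite_finite_induct) (simp_all add: pf_const pf_add)

lemma polyfun_prod:
  assumes "\<And>i. i \<in> S \<Longrightarrow> f i \<in> polyfun C"
  shows "(\<lambda>x. \<Prod>i\<in>S. f i x) \<in> polyfun C"
  using assms by (induction S rule: infinite_finite_induct) (simp_all add: pf_const pf_mult)

lemma polyfun_det:
  fixes A :: "'a \<Rightarrow> complex^'n^'n"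
  assumes "\<And>i j. (\<lambda>x. A x $ i $ j) \<in> polyfun C"
  shows "(\<lambda>x. det (A x)) \<in> polyfun C"
  unfolding det_def by (intro polyfun_sum pf_mult pf_const polyfun_prod assms)

lemma polyfun_bdot:
  assumes "v \<in> polymap C" "w \<in> polymap C"
  shows "(\<lambda>x. bdot (v x) (w x)) \<in> polyfun C"
  using assms by (auto simp: bdot_def polymap_def intro!: polyfun_sum pf_mult)

lemma polymap_const: "(\<lambda>x. b) \<in> polymap C"
  by (simp add: polymap_def pf_const)

lemma polymap_add: "v \<in> polymap C \<Longrightarrow> w \<in> polymap C \<Longrightarrow> (\<lambda>x. v x + w x) \<in> polymap C"
  by (simp add: polymap_def pf_add)

lemma polymap_diff: "v \<in> polymap C \<Longrightarrow> w \<in> polymap C \<Longrightarrow> (\<lambda>x. v x - w x) \<in> polymap C"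
  by (simp add: polymap_def polyfun_diff)

lemma polymap_scale: "f \<in> polyfun C \<Longrightarrow> v \<in> polymap C \<Longrightarrow> (\<lambda>x. f x *s v x) \<in> polymap C"
  by (simp add: polymap_def pf_mult)

lemma polyfun_component: "(\<lambda>x. x $ i) \<in> polyfun coordsV"
  by (auto simp: coordsV_def intro: pf_coord)

lemma polymap_id: "(\<lambda>x. x) \<in> polymap coordsV"
  by (simp add: polymap_def polyfun_component)

lemma polymap_fst: "fst \<in> polymap coordsP"
  by (auto simp: polymap_def coordsP_def intro: pf_coord)

lemma polymap_snd: "snd \<in> polymap coordsP"
  by (auto simp: polymap_def coordsP_def intro: pf_coord)

lemma polyfun_compose:
  assumes "f \<in> polyfun C" and "\<And>c. c \<in> C \<Longrightarrow> (\<lambda>x. c (\<phi> x)) \<in> polyfun C'"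
  shows "(\<lambda>x. f (\<phi> x)) \<in> polyfun C'"
  using assms(1) by induction (auto intro: pf_const pf_add pf_mult assms(2))

lemma polyfun_compose_coordsV:
  assumes "f \<in> polyfun coordsV" "\<phi> \<in> polymap C"
  shows "(\<lambda>x. f (\<phi> x)) \<in> polyfun C"
  using assms(2) by (intro polyfun_compose[OF assms(1)]) (auto simp: polymap_def coordsV_def)

lemma polymap_compose_coordsV:
  assumes "v \<in> polymap coordsV" "\<phi> \<in> polymap C"
  shows "(\<lambda>x. v (\<phi> x)) \<in> polymap C"
  using assms polyfun_compose_coordsV[of "\<lambda>x. v x $ i" \<phi> C for i] by (simp add: polymap_def)

lemma polymap_compose_coordsP:
  assumes "v \<in> polymap coordsP" "\<phi> \<in> polymap C" "\<psi> \<in> polymap C"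
  shows "(\<lambda>x. v (\<phi> x, \<psi> x)) \<in> polymap C"
proof -
  have "(\<lambda>x. c (\<phi> x, \<psi> x)) \<in> polyfun C" if "c \<in> coordsP" for c
    using that assms(2,3) by (auto simp: polymap_def coordsP_def)
  then show ?thesis
    using assms(1) polyfun_compose[of "\<lambda>x. v x $ i" coordsP "\<lambda>x. (\<phi> x, \<psi> x)" C for i]
    by (simp add: polymap_def)
qed

lemma continuous_on_polymap:
  fixes v :: "complex^'m \<Rightarrow> complex^'n"
  assumes "v \<in> polymap coordsV"
  shows "continuous_on S v"
proof -
  have "continuous_on S f" if "f \<in> polyfun coordsV" for f :: "complex^'m \<Rightarrow> complex"
    using that by induction (auto simp: coordsV_def intro: continuous_on_component
        continuous_on_add continuous_on_mult)
  then have "continuous_on S (\<lambda>x. \<chi> i. v x $ i)"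
    using assms by (intro continuous_on_vec_lambda) (simp add: polymap_def)
  then show ?thesis by simp
qed

lemma holomorphic_on_polyfun:
  assumes "f \<in> polyfun coordsV" and "\<And>i. (\<lambda>t. \<gamma> t $ i) holomorphic_on S"
  shows "(\<lambda>t. f (\<gamma> t)) holomorphic_on S"
  using assms(1) by induction (auto simp: coordsV_def intro: holomorphic_intros assms(2))

lemma (in bounded_bilinear) has_derivative_if_difference_factors:
  assumes diff: "\<And>x. f x - f y = prod (B x) (x - y)" and cont: "isCont B y"
  shows "(f has_derivative prod (B y)) (at y)"
proof (rule has_derivativeI[OF bounded_linear_right])
  obtain K where K: "\<And>a b. norm (prod a b) \<le> norm a * norm b * K"
    using bounded by blast
  have bound: "norm ((f x - f y - prod (B y) (x - y)) /\<^sub>R norm (x - y)) \<le> norm (B x - B y) * K"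
    if "x \<noteq> y" for x
    using K[of "B x - B y" "x - y"] that
    by (simp add: diff diff_left[symmetric] divide_simps mult_ac)
  have "((\<lambda>x. B x - B y) \<longlongrightarrow> 0) (at y)"
    using cont by (simp add: isCont_def LIM_zero)
  then have "((\<lambda>x. norm (B x - B y) * K) \<longlongrightarrow> 0) (at y)"
    by (intro tendsto_mult_left_zero tendsto_norm_zero)
  then show "((\<lambda>x. (f x - f y - prod (B y) (x - y)) /\<^sub>R norm (x - y)) \<longlongrightarrow> 0) (at y)"
    by (rule Lim_null_comparison[rotated]) (simp add: eventually_at_filter bound del: norm_scaleR)
qed

definition difference_quotient ::
    "(complex^'n \<Rightarrow> complex) \<Rightarrow> ((complex^'n) \<times> (complex^'n) \<Rightarrow> complex^'n) \<Rightarrow> bool" where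
  "difference_quotient f B \<longleftrightarrow>
    B \<in> polymap coordsP \<and> (\<forall>x y. f x - f y = bdot (B (x, y)) (x - y))"

lemma polyfun_difference_quotient_exists:
  assumes "f \<in> polyfun (coordsV :: (complex^'n \<Rightarrow> complex) set)"
  obtains B where "difference_quotient f B"
proof -
  have "\<exists>B. difference_quotient f B"
    using assms
  proof induction
    case (pf_const c)
    have "difference_quotient (\<lambda>x :: complex^'n. c) (\<lambda>_. 0)"
      by (simp add: difference_quotient_def polymap_const bdot.zero_left)
    then show ?case by blast
  next
    case (pf_coord f)
    then obtain i where "f = (\<lambda>x. x $ i)" by (auto simp: coordsV_def)
    then have "difference_quotient f (\<lambda>_. axis i 1)"
      by (simp add: difference_quotient_def polymap_const bdot_commute[of "axis i 1"]
          bdot_axis_right)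
    then show ?case by blast
  next
    case (pf_add f g)
    then obtain B B' where "difference_quotient f B" "difference_quotient g B'" by blast
    then have "difference_quotient (\<lambda>x. f x + g x) (\<lambda>z. B z + B' z)"
      by (simp add: difference_quotient_def polymap_add bdot.add_left add_diff_add)
    then show ?case by blast
  next
    case (pf_mult f g)
    then obtain B B' where BB': "difference_quotient f B" "difference_quotient g B'" by blast
    have "(\<lambda>z. g (fst z)) \<in> polyfun coordsP" "(\<lambda>z. f (snd z)) \<in> polyfun coordsP"
      using pf_mult.hyps polyfun_compose_coordsV polymap_fst polymap_snd by blast+
    moreover have "f x * g x - f y * g y = g x * (f x - f y) + f y * (g x - g y)" for x y
      by (simp add: algebra_simps)
    ultimately have "difference_quotient (\<lambda>x. f x * g x) (\<lambda>z. g (fst z) *s B z + f (snd z) *s B' z)"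
      using BB'
      by (simp add: difference_quotient_def polymap_add polymap_scale bdot.add_left bdot_scale_left)
    then show ?case by blast
  qed
  then show thesis using that by blast
qed

lemma has_derivative_difference_quotient:
  assumes "difference_quotient f B"
  shows "(f has_derivative bdot (B (y, y))) (at y)"
proof (rule bdot.has_derivative_if_difference_factors[where B = "\<lambda>x. B (x, y)"])
  show "f x - f y = bdot (B (x, y)) (x - y)" for x
    using assms by (simp add: difference_quotient_def)
  have "(\<lambda>x. B (x, y)) \<in> polymap coordsV"
    using assms polymap_compose_coordsP[of B, OF _ polymap_id polymap_const]
    by (simp add: difference_quotient_def)
  then show "isCont (\<lambda>x. B (x, y)) y"
    using continuous_on_polymap[of "\<lambda>x. B (x, y)" UNIV]
    by (simp add: continuous_on_eq_continuous_at)
qed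

lemma has_derivative_complex_line:
  fixes x v :: "complex^'n"
  shows "((\<lambda>t. x + t *s v) has_derivative (\<lambda>h. h *s v)) (at t)"
proof -
  have "bounded_linear (\<lambda>h. h *s v)"
    by (intro linear_conv_bounded_linear[THEN iffD1] linearI) (auto simp: vec_eq_iff ring_distribs)
  then show ?thesis
    by (auto intro!: derivative_eq_intros bounded_linear_imp_has_derivative)
qed

lemma gradient_eqI:
  fixes x :: "complex^'n"
  assumes "(f has_derivative bdot d) (at x)"
  shows "gradient f x = d"
proof -
  have "partial_deriv f i x = d $ i" for i
  proof -
    have "(\<chi> j. if j = i then t else 0) = t *s axis i 1" for t :: complex
      by (auto simp: vec_eq_iff axis_def)
    moreover
    from has_derivative_compose[OF has_derivative_complex_line[of x "axis i 1" 0], of f "bdot d"]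
    have "((\<lambda>t. f (x + t *s axis i 1)) has_derivative (\<lambda>t. d $ i * t)) (at 0)"
      using assms by (simp add: bdot_scale_right bdot_axis_right mult.commute)
    ultimately show ?thesis
      by (simp add: partial_deriv_def has_field_derivative_def DERIV_imp_deriv)
  qed
  then show ?thesis by (simp add: gradient_def vec_eq_iff)
qed

lemma gradient_difference_quotient: "difference_quotient f B \<Longrightarrow> gradient f y = B (y, y)"
  by (intro gradient_eqI has_derivative_difference_quotient)

lemma polyfun_has_derivative:
  assumes "f \<in> polyfun coordsV"
  shows "(f has_derivative bdot (gradient f x)) (at x)"
  using assms
  by (metis polyfun_difference_quotient_exists has_derivative_difference_quotient
      gradient_difference_quotient)

lemma polymap_gradient:
  assumes "f \<in> polyfun coordsV"
  shows "gradient f \<in> polymap coordsV"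
proof -
  obtain B where B: "difference_quotient f B"
    using assms polyfun_difference_quotient_exists by blast
  then have "(\<lambda>y. B (y, y)) \<in> polymap coordsV"
    using polymap_compose_coordsP[of B, OF _ polymap_id polymap_id]
    by (simp add: difference_quotient_def)
  moreover have "gradient f = (\<lambda>y. B (y, y))"
    using gradient_difference_quotient[OF B] by blast
  ultimately show ?thesis by simp
qed

lemma gradient_bdot: "gradient (bdot b) x = b"
  by (intro gradient_eqI bounded_linear_imp_has_derivative bdot.bounded_linear_right)

definition jacobian :: "('m \<Rightarrow> complex^'n \<Rightarrow> complex) \<Rightarrow> complex^'n \<Rightarrow> complex^'n^'m" where
  "jacobian a x = (\<chi> i. gradient (a i) x)"

lemma jacobian_nth [simp]: "jacobian a x $ i = gradient (a i) x"
  by (simp add: jacobian_def)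

definition sq_dist :: "complex^'n \<Rightarrow> complex^'n \<Rightarrow> complex" where
  "sq_dist u x = bdot (x - u) (x - u)"

lemma polyfun_sq_dist: "sq_dist u \<in> polyfun coordsV"
  unfolding sq_dist_def[abs_def] by (intro polyfun_bdot polymap_diff polymap_id polymap_const)

lemma gradient_sq_dist: "gradient (sq_dist u) x = 2 *s (x - u)"
proof (rule gradient_eqI)
  have "((\<lambda>x. bdot (x - u) (x - u)) has_derivative (\<lambda>h. bdot (x - u) h + bdot h (x - u))) (at x)"
    by (auto intro!: derivative_eq_intros bdot.FDERIV)
  then show "(sq_dist u has_derivative bdot (2 *s (x - u))) (at x)"
    by (simp add: sq_dist_def[abs_def] bdot_commute[of _ "x - u"] bdot_scale_left[abs_def]
        del: vector_ssub_ldistrib)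
qed

section \<open>Zariski closed sets\<close>

lemma zariski_closed_iff_zero_set_vanishing_ideal:
  "zariski_closed C S \<longleftrightarrow> zero_set (vanishing_ideal C S) = S"
proof
  assume "zariski_closed C S"
  then obtain F where F: "F \<subseteq> polyfun C" "S = zero_set F"
    by (auto simp: zariski_closed_def)
  then have "F \<subseteq> vanishing_ideal C S" by (auto simp: vanishing_ideal_def zero_set_def)
  then show "zero_set (vanishing_ideal C S) = S"
    using F(2) by (auto simp: vanishing_ideal_def zero_set_def)
next
  assume "zero_set (vanishing_ideal C S) = S"
  moreover have "vanishing_ideal C S \<subseteq> polyfun C" by (auto simp: vanishing_ideal_def)
  ultimately show "zariski_closed C S" unfolding zariski_closed_def by metis
qed

lemma zariski_closed_Inter:
  assumes "\<And>S. S \<in> \<S> \<Longrightarrow> zariski_closed C S"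
  shows "zariski_closed C (\<Inter>\<S>)"
proof -
  have "\<Inter>\<S> = zero_set (\<Union>S\<in>\<S>. vanishing_ideal C S)"
    using assms by (auto simp: zariski_closed_iff_zero_set_vanishing_ideal zero_set_def)
  moreover have "(\<Union>S\<in>\<S>. vanishing_ideal C S) \<subseteq> polyfun C"
    by (auto simp: vanishing_ideal_def)
  ultimately show ?thesis unfolding zariski_closed_def by blast
qed

lemma zariski_closed_level:
  assumes "f \<in> polyfun C"
  shows "zariski_closed C {x. f x = c}"
proof -
  have "{x. f x = c} = zero_set {\<lambda>x. f x - c}" by (auto simp: zero_set_def)
  moreover have "{\<lambda>x. f x - c} \<subseteq> polyfun C" using polyfun_diff[OF assms pf_const] by simp
  ultimately show ?thesis unfolding zariski_closed_def by blast
qed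

lemma zariski_closed_singleton: "zariski_closed coordsV {y :: complex^'n}"
proof -
  have "zariski_closed coordsV (\<Inter>i. {x. x $ i = y $ i})"
    by (intro zariski_closed_Inter) (auto intro: zariski_closed_level polyfun_component)
  moreover have "(\<Inter>i. {x. x $ i = y $ i}) = {y}" by (auto simp: vec_eq_iff)
  ultimately show ?thesis by simp
qed

lemma zariski_closed_vimage:
  assumes "zariski_closed C S" and "\<And>c. c \<in> C \<Longrightarrow> (\<lambda>x. c (\<phi> x)) \<in> polyfun C'"
  shows "zariski_closed C' (\<phi> -` S)"
proof -
  have "\<phi> -` S = (\<Inter>f\<in>vanishing_ideal C S. {x. f (\<phi> x) = 0})"
    using assms(1) by (auto simp: zariski_closed_iff_zero_set_vanishing_ideal zero_set_def)
  moreover have "(\<lambda>x. f (\<phi> x)) \<in> polyfun C'" if "f \<in> vanishing_ideal C S" for f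
    using that by (auto simp: vanishing_ideal_def intro: polyfun_compose[OF _ assms(2)])
  ultimately show ?thesis by (auto intro!: zariski_closed_Inter zariski_closed_level)
qed

lemma zariski_closure_eq_hull: "zariski_closure C S = zariski_closed C hull S"
  by (simp add: zariski_closure_def hull_def)

lemma zariski_closed_closure: "zariski_closed C (zariski_closure C S)"
  unfolding zariski_closure_eq_hull by (rule hull_in) (simp add: zariski_closed_Inter)

lemma zariski_closure_superset: "S \<subseteq> zariski_closure C S"
  unfolding zariski_closure_eq_hull by (rule hull_subset)

lemma zariski_closure_minimal: "zariski_closed C Z \<Longrightarrow> S \<subseteq> Z \<Longrightarrow> zariski_closure C S \<subseteq> Z"
  unfolding zariski_closure_eq_hull by (rule hull_minimal)

lemma constant_on_zariski_closure:
  assumes "f \<in> polyfun C" "f constant_on S"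
  shows "f constant_on zariski_closure C S"
proof -
  obtain c where "S \<subseteq> {x. f x = c}" using assms(2) by (auto simp: constant_on_def)
  then have "zariski_closure C S \<subseteq> {x. f x = c}"
    by (rule zariski_closure_minimal[OF zariski_closed_level[OF assms(1)]])
  then show ?thesis unfolding constant_on_def by blast
qed

lemma zariski_irreducible_singleton: "zariski_irreducible coordsV {y :: complex^'n}"
proof -
  have "{y} = A \<or> {y} = B" if "{y} = A \<union> B" for A B
    using that by (metis Un_singleton_iff)
  then show ?thesis
    unfolding zariski_irreducible_def by (simp add: zariski_closed_singleton)
qed

lemma zariski_irreducible_subset_Un:
  assumes S: "zariski_irreducible C S" and AB: "zariski_closed C A" "zariski_closed C B" "S \<subseteq> A \<union> B"
  shows "S \<subseteq> A \<or> S \<subseteq> B"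
proof -
  have "zariski_closed C (S \<inter> T)" if "zariski_closed C T" for T
    using that S zariski_closed_Inter[of "{S, T}" C] by (auto simp: zariski_irreducible_def)
  moreover have "S = (S \<inter> A) \<union> (S \<inter> B)" using AB(3) by blast
  ultimately have "S = S \<inter> A \<or> S = S \<inter> B"
    using S AB(1,2) unfolding zariski_irreducible_def by blast
  then show ?thesis by blast
qed

lemma zariski_irreducible_closure:
  assumes "S \<noteq> {}"
    and prime: "\<And>f g. f \<in> polyfun C \<Longrightarrow> g \<in> polyfun C \<Longrightarrow> \<forall>x\<in>S. f x * g x = 0 \<Longrightarrow>
      (\<forall>x\<in>S. f x = 0) \<or> (\<forall>x\<in>S. g x = 0)"
  shows "zariski_irreducible C (zariski_closure C S)"
proof -
  let ?Z = "zariski_closure C S"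
  have "?Z = A \<or> ?Z = B"
    if A: "zariski_closed C A" and B: "zariski_closed C B" and Z: "?Z = A \<union> B" for A B
  proof (rule ccontr)
    assume "\<not> ?thesis"
    then have "\<not> S \<subseteq> zero_set (vanishing_ideal C A)" "\<not> S \<subseteq> zero_set (vanishing_ideal C B)"
      using zariski_closure_minimal[OF A, of S] zariski_closure_minimal[OF B, of S] Z A B
      unfolding zariski_closed_iff_zero_set_vanishing_ideal by blast+
    then obtain f g where f: "f \<in> vanishing_ideal C A" "\<exists>x\<in>S. f x \<noteq> 0"
        and g: "g \<in> vanishing_ideal C B" "\<exists>x\<in>S. g x \<noteq> 0"
      unfolding zero_set_def by blast
    have "\<forall>x\<in>S. f x * g x = 0"
      using f(1) g(1) Z zariski_closure_superset[of S C] by (auto simp: vanishing_ideal_def)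
    then show False
      using prime[of f g] f g by (auto simp: vanishing_ideal_def)
  qed
  moreover have "?Z \<noteq> {}" using zariski_closure_superset[of S C] assms(1) by blast
  ultimately show ?thesis
    unfolding zariski_irreducible_def by (simp add: zariski_closed_closure)
qed

lemma holomorphic_mult_eq_0_cases:
  assumes "f holomorphic_on S" "g holomorphic_on S" "open S" "connected S"
    and zero: "\<And>t. t \<in> S \<Longrightarrow> f t * g t = 0"
  shows "(\<forall>t\<in>S. f t = 0) \<or> (\<forall>t\<in>S. g t = 0)"
proof (rule disjCI)
  assume "\<not> (\<forall>t\<in>S. g t = 0)"
  moreover have "S \<inter> g -` (- {0}) = {t \<in> S. g t \<noteq> 0}" by auto
  ultimately have "open {t \<in> S. g t \<noteq> 0}" "{t \<in> S. g t \<noteq> 0} \<noteq> {}"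
    using continuous_open_preimage[OF holomorphic_on_imp_continuous_on[OF assms(2)] assms(3),
        of "- {0}"]
    by auto
  then show "\<forall>t\<in>S. f t = 0"
    using analytic_continuation_open[of "{t \<in> S. g t \<noteq> 0}" S f "\<lambda>_. 0"] assms by fastforce
qed

lemma zariski_irreducible_closure_holomorphic_image:
  fixes \<gamma> :: "complex \<Rightarrow> complex^'n"
  assumes "\<And>i. (\<lambda>t. \<gamma> t $ i) holomorphic_on S" "open S" "connected S" "S \<noteq> {}"
  shows "zariski_irreducible coordsV (zariski_closure coordsV (\<gamma> ` S))"
proof (rule zariski_irreducible_closure)
  fix f g :: "complex^'n \<Rightarrow> complex"
  assume "f \<in> polyfun coordsV" "g \<in> polyfun coordsV" "\<forall>x\<in>\<gamma> ` S. f x * g x = 0"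
  then show "(\<forall>x\<in>\<gamma> ` S. f x = 0) \<or> (\<forall>x\<in>\<gamma> ` S. g x = 0)"
    using holomorphic_mult_eq_0_cases[of "\<lambda>t. f (\<gamma> t)" S "\<lambda>t. g (\<gamma> t)"]
      holomorphic_on_polyfun[OF _ assms(1)] assms(2,3) by auto
qed (use assms in auto)

lemma dim_ge_mono:
  assumes "dim_ge C S k" "S \<subseteq> T"
  shows "dim_ge C T k"
proof -
  obtain Z where "\<forall>i\<le>k. zariski_irreducible C (Z i) \<and> Z i \<subseteq> S" "\<forall>i<k. Z i \<subset> Z (Suc i)"
    using assms(1) by (auto simp: dim_ge_def)
  with assms(2) show ?thesis
    unfolding dim_ge_def by (intro exI[of _ Z]) auto
qed

lemma dim_ge_antimono:
  assumes "dim_ge C S k" "l \<le> k"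
  shows "dim_ge C S l"
proof -
  obtain Z where "\<forall>i\<le>k. zariski_irreducible C (Z i) \<and> Z i \<subseteq> S" "\<forall>i<k. Z i \<subset> Z (Suc i)"
    using assms(1) by (auto simp: dim_ge_def)
  with assms(2) show ?thesis
    unfolding dim_ge_def by (intro exI[of _ Z]) auto
qed

lemma dim_ge_1_iff:
  "dim_ge C S 1 \<longleftrightarrow> (\<exists>A B. zariski_irreducible C A \<and> zariski_irreducible C B \<and> A \<subset> B \<and> B \<subseteq> S)"
  (is "_ \<longleftrightarrow> ?R")
proof
  assume "dim_ge C S 1"
  then obtain Z where "\<forall>i\<le>1. zariski_irreducible C (Z i) \<and> Z i \<subseteq> S" "\<forall>i<1. Z i \<subset> Z (Suc i)"
    by (auto simp: dim_ge_def)
  then show ?R by (intro exI[of _ "Z 0"] exI[of _ "Z 1"]) auto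
next
  assume ?R
  then obtain A B where "zariski_irreducible C A" "zariski_irreducible C B" "A \<subset> B" "B \<subseteq> S"
    by blast
  then show "dim_ge C S 1"
    unfolding dim_ge_def by (intro exI[of _ "\<lambda>i::nat. if i = 0 then A else B"]) auto
qed

lemma dim_ge_2I:
  assumes "zariski_irreducible C A" "zariski_irreducible C B" "zariski_irreducible C S"
    "A \<subset> B" "B \<subset> S"
  shows "dim_ge C S 2"
proof -
  let ?Z = "\<lambda>i::nat. if i = 0 then A else if i = 1 then B else S"
  have "zariski_irreducible C (?Z i) \<and> ?Z i \<subseteq> S" for i
    using assms by auto
  moreover have "?Z i \<subset> ?Z (Suc i)" if "i < 2" for i
    using that assms(4,5) less_2_cases[of i] by auto
  ultimately show ?thesis unfolding dim_ge_def by (intro exI[of _ ?Z]) simp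
qed

lemma alg_dim_eqI:
  assumes "dim_ge C S k" "\<not> dim_ge C S (Suc k)"
  shows "alg_dim C S = k"
  unfolding alg_dim_def
proof (rule Greatest_equality)
  show "l \<le> k" if "dim_ge C S l" for l
    using that assms(2) dim_ge_antimono[of C S l "Suc k"] by (auto simp: not_less_eq_eq[symmetric])
qed fact

lemma irreducible_curve_irreducible: "irreducible_curve X \<Longrightarrow> zariski_irreducible coordsV X"
  by (simp add: irreducible_curve_def)

lemma irreducible_curve_closed: "irreducible_curve X \<Longrightarrow> zariski_closed coordsV X"
  by (simp add: irreducible_curve_def zariski_irreducible_def)

lemma irreducible_curve_eq_if_chain:
  assumes "irreducible_curve X" "zariski_irreducible coordsV A" "zariski_irreducible coordsV B"
    "A \<subset> B" "B \<subseteq> X"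
  shows "B = X"
  using assms dim_ge_2I[of coordsV A B X] by (auto simp: irreducible_curve_def)

lemma irreducible_curve_not_singleton:
  assumes "irreducible_curve X"
  shows "X \<noteq> {y}"
proof
  assume "X = {y}"
  then obtain A where "zariski_irreducible coordsV A" "A \<subset> {y}"
    using assms unfolding irreducible_curve_def dim_ge_1_iff by blast
  then show False by (auto simp: zariski_irreducible_def)
qed

lemma alg_dim_irreducible_curve: "irreducible_curve X \<Longrightarrow> alg_dim coordsV X = 1"
  by (intro alg_dim_eqI) (simp_all add: irreducible_curve_def numeral_2_eq_2)

section \<open>Holomorphic arcs tangent to a variety\<close>

lemma holomorphic_family_closed_under_deriv_eq_0:
  assumes S: "open S" "connected S" "z \<in> S"
    and hol: "\<And>h. h \<in> H \<Longrightarrow> h holomorphic_on S"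
    and zero: "\<And>h. h \<in> H \<Longrightarrow> h z = 0"
    and deriv: "\<And>h. h \<in> H \<Longrightarrow> \<exists>k\<in>H. \<exists>g. g holomorphic_on S \<and> (\<forall>t\<in>S. deriv h t = k t * g t)"
    and h: "h \<in> H" and t: "t \<in> S"
  shows "h t = 0"
proof -
  have "(deriv ^^ n) h z = 0" if "h \<in> H" for n h
    using that
  proof (induction n arbitrary: h rule: less_induct)
    case (less n)
    show ?case
    proof (cases n)
      case 0
      then show ?thesis using zero less.prems by simp
    next
      case (Suc m)
      obtain k g where k: "k \<in> H" and g: "g holomorphic_on S"
          and eq: "\<And>t. t \<in> S \<Longrightarrow> deriv h t = k t * g t"
        using deriv[OF less.prems] by blast
      have "(deriv ^^ n) h z = (deriv ^^ m) (deriv h) z"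
        by (simp add: Suc funpow_swap1)
      also have "\<dots> = (deriv ^^ m) (\<lambda>t. k t * g t) z"
        using S hol[OF less.prems] hol[OF k] g eq
        by (intro higher_deriv_transform_within_open)
          (auto intro: holomorphic_on_mult holomorphic_deriv)
      also have "\<dots> = (\<Sum>i = 0..m. of_nat (m choose i) * (deriv ^^ i) k z * (deriv ^^ (m - i)) g z)"
        by (rule higher_deriv_mult[OF hol[OF k] g S(1,3)])
      also have "\<dots> = 0"
        using less.IH[OF _ k] by (simp add: Suc)
      finally show ?thesis .
    qed
  qed
  then show ?thesis
    using holomorphic_fun_eq_0_on_connected[OF hol[OF h] S(1,2) _ S(3) t] h by blast
qed

definition integral_arc ::
    "(complex^'n \<Rightarrow> complex^'n) \<Rightarrow> (complex^'n \<Rightarrow> complex) \<Rightarrow> complex set \<Rightarrow>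
      (complex \<Rightarrow> complex^'n) \<Rightarrow> bool"
  where
  "integral_arc v q S \<gamma> \<longleftrightarrow>
    (\<forall>t\<in>S. q (\<gamma> t) \<noteq> 0 \<and> (\<gamma> has_derivative (\<lambda>h. h *s ((1 / q (\<gamma> t)) *s v (\<gamma> t)))) (at t))"

lemma integral_arc_has_field_derivative:
  assumes "integral_arc v q S \<gamma>" "f \<in> polyfun coordsV" "t \<in> S"
  shows "((\<lambda>t. f (\<gamma> t)) has_field_derivative bdot (v (\<gamma> t)) (gradient f (\<gamma> t)) / q (\<gamma> t)) (at t)"
proof -
  have "((\<lambda>t. f (\<gamma> t)) has_derivative
      (\<lambda>h. bdot (gradient f (\<gamma> t)) (h *s ((1 / q (\<gamma> t)) *s v (\<gamma> t))))) (at t)"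
    using assms(1,3) has_derivative_compose[OF _ polyfun_has_derivative[OF assms(2)], of \<gamma> _ t UNIV]
    by (auto simp: integral_arc_def)
  then show ?thesis
    by (rule has_derivative_imp_has_field_derivative) (simp add: bdot_scale_right bdot_commute)
qed

lemma integral_arc_holomorphic:
  assumes "integral_arc v q S \<gamma>" "f \<in> polyfun coordsV" "open S"
  shows "(\<lambda>t. f (\<gamma> t)) holomorphic_on S"
  unfolding holomorphic_on_open[OF assms(3)]
  using integral_arc_has_field_derivative[OF assms(1,2)] by blast

lemma constant_on_integral_arc:
  assumes arc: "integral_arc v q S \<gamma>" and f: "f \<in> polyfun coordsV" and S: "connected S" "open S"
    and orth: "\<And>t. t \<in> S \<Longrightarrow> bdot (v (\<gamma> t)) (gradient f (\<gamma> t)) = 0"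
  shows "f constant_on \<gamma> ` S"
proof -
  have "((\<lambda>t. f (\<gamma> t)) has_field_derivative 0) (at t)" if "t \<in> S" for t
    using integral_arc_has_field_derivative[OF arc f that] orth[OF that] by simp
  then have "(\<lambda>t. f (\<gamma> t)) constant_on S"
    by (rule has_field_derivative_0_imp_constant_on[OF _ S])
  then show ?thesis by (auto simp: constant_on_def)
qed

lemma gradient_in_normal_space:
  "f \<in> vanishing_ideal coordsV X \<Longrightarrow> gradient f x \<in> normal_space_at X x"
  unfolding normal_space_at_def by (intro vec.span_base imageI)

definition tangent_field :: "(complex^'n) set \<Rightarrow> (complex^'n \<Rightarrow> complex^'n) \<Rightarrow> bool" where
  "tangent_field X v \<longleftrightarrow>
    v \<in> polymap coordsV \<and> (\<forall>x\<in>X. \<forall>y\<in>normal_space_at X x. bdot (v x) y = 0)"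

lemma tangent_field_preserves_vanishing_ideal:
  assumes v: "tangent_field X v" and f: "f \<in> vanishing_ideal coordsV X"
  shows "(\<lambda>x. bdot (v x) (gradient f x)) \<in> vanishing_ideal coordsV X"
  using v f gradient_in_normal_space[OF f] polyfun_bdot[OF _ polymap_gradient[of f], of v]
  by (auto simp: tangent_field_def vanishing_ideal_def)

text \<open>Differentiation along the arc maps the restrictions of the ideal to multiples of such
  restrictions, so these vanish to infinite order at the point where the arc meets \<open>X\<close>.\<close>

lemma integral_arc_subset_variety:
  assumes X: "zariski_closed coordsV X" and v: "tangent_field X v"
    and q: "q \<in> polyfun coordsV" and arc: "integral_arc v q S \<gamma>"
    and S: "open S" "connected S" "s \<in> S" "\<gamma> s \<in> X"
  shows "\<gamma> ` S \<subseteq> X"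
proof -
  have "f (\<gamma> t) = 0" if f: "f \<in> vanishing_ideal coordsV X" and t: "t \<in> S" for f t
  proof (rule holomorphic_family_closed_under_deriv_eq_0[OF S(1-3), where
        H = "(\<lambda>f t. f (\<gamma> t)) ` vanishing_ideal coordsV X" and h = "\<lambda>t. f (\<gamma> t)"])
    fix h assume "h \<in> (\<lambda>f t. f (\<gamma> t)) ` vanishing_ideal coordsV X"
    then obtain f where f: "f \<in> vanishing_ideal coordsV X" and h: "h = (\<lambda>t. f (\<gamma> t))" by blast
    then have f_poly: "f \<in> polyfun coordsV" by (simp add: vanishing_ideal_def)
    show "h holomorphic_on S"
      unfolding h by (rule integral_arc_holomorphic[OF arc f_poly S(1)])
    show "h s = 0" using f S(4) by (simp add: h vanishing_ideal_def)
    have "(\<lambda>t. 1 / q (\<gamma> t)) holomorphic_on S"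
      using arc by (intro holomorphic_intros integral_arc_holomorphic[OF arc q S(1)])
        (auto simp: integral_arc_def)
    moreover have "deriv h t = bdot (v (\<gamma> t)) (gradient f (\<gamma> t)) * (1 / q (\<gamma> t))" if "t \<in> S" for t
      using DERIV_imp_deriv[OF integral_arc_has_field_derivative[OF arc f_poly that]]
      by (simp add: h)
    moreover have "(\<lambda>t. bdot (v (\<gamma> t)) (gradient f (\<gamma> t)))
        \<in> (\<lambda>f t. f (\<gamma> t)) ` vanishing_ideal coordsV X"
      by (rule image_eqI[OF _ tangent_field_preserves_vanishing_ideal[OF v f]]) simp
    ultimately show "\<exists>k\<in>(\<lambda>f t. f (\<gamma> t)) ` vanishing_ideal coordsV X.
        \<exists>g. g holomorphic_on S \<and> (\<forall>t\<in>S. deriv h t = k t * g t)"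
      by (intro bexI exI[of _ "\<lambda>t. 1 / q (\<gamma> t)"] conjI) auto
  qed (use f t in auto)
  then show ?thesis
    using X by (auto simp: zariski_closed_iff_zero_set_vanishing_ideal zero_set_def)
qed

section \<open>Polynomial coordinates\<close>

lemma has_derivative_vec_lambda:
  fixes a :: "'n::finite \<Rightarrow> 'a::real_normed_vector \<Rightarrow> 'b::euclidean_space"
  assumes "\<And>i. (a i has_derivative a' i) (at x)"
  shows "((\<lambda>x. \<chi> i. a i x) has_derivative (\<lambda>h. \<chi> i. a' i h)) (at x)"
  unfolding has_derivative_componentwise_within[of "\<lambda>x. \<chi> i. a i x"]
proof
  fix b :: "'b^'n" assume "b \<in> Basis"
  then obtain i u where b: "b = axis i u" by (auto simp: Basis_vec_def)
  show "((\<lambda>x. (\<chi> i. a i x) \<bullet> b) has_derivative (\<lambda>h. (\<chi> i. a' i h) \<bullet> b)) (at x)"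
    unfolding b inner_axis using has_derivative_inner_left[OF assms] by simp
qed

lemma inverse_function_theorem_matrix:
  fixes F :: "'a::{euclidean_space, real_normed_field}^'n \<Rightarrow> 'a^'n" and A :: "'a^'n \<Rightarrow> 'a^'n^'n"
  assumes U: "open U" "x0 \<in> U"
    and deriv: "\<And>x. x \<in> U \<Longrightarrow> (F has_derivative (*v) (A x)) (at x)"
    and cont: "\<And>i j. continuous_on U (\<lambda>x. A x $ i $ j)"
    and nonsingular: "det (A x0) \<noteq> 0"
  obtains V g where "open V" "F x0 \<in> V" "g (F x0) = x0"
    "\<And>y. y \<in> V \<Longrightarrow> F (g y) = y" "\<And>y. y \<in> V \<Longrightarrow> det (A (g y)) \<noteq> 0"
    "\<And>y. y \<in> V \<Longrightarrow> (g has_derivative (*v) (matrix_inv (A (g y)))) (at y)"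
proof -
  define W where "W = U \<inter> (\<lambda>x. det (A x)) -` (- {0})"
  define F' where "F' x = Blinfun ((*v) (A x))" for x
  have apply_F': "blinfun_apply (F' x) = (*v) (A x)" for x
    unfolding F'_def by (rule bounded_linear_Blinfun_apply[OF matrix_vector_mul_bounded_linear])
  have "continuous_on U (\<lambda>x. det (A x))"
    unfolding det_def by (intro continuous_intros cont)
  then have "open W" "x0 \<in> W"
    unfolding W_def using U nonsingular by (auto intro!: continuous_open_preimage)
  moreover have "(F has_derivative blinfun_apply (F' x)) (at x)" if "x \<in> W" for x
    using deriv that by (simp add: apply_F' W_def)
  moreover have "continuous_on W F'"
  proof (rule continuous_on_blinfun_componentwise)
    fix b :: "'a^'n"
    show "continuous_on W (\<lambda>x. blinfun_apply (F' x) b)"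
      unfolding apply_F' matrix_vector_mult_def
      by (intro continuous_intros continuous_on_subset[OF cont]) (auto simp: W_def)
  qed
  moreover have "Blinfun ((*v) (matrix_inv (A x0))) o\<^sub>L F' x0 = id_blinfun"
    by (rule blinfun_eqI)
      (simp add: apply_F' bounded_linear_Blinfun_apply matrix_inv_vector_mult nonsingular)
  ultimately obtain W' V g g' where IFT: "W' \<subseteq> W" "x0 \<in> W'" "open V" "F x0 \<in> V"
      "homeomorphism W' V F g" "\<And>y. y \<in> V \<Longrightarrow> (g has_derivative g' y) (at y)"
      "\<And>y. y \<in> V \<Longrightarrow> g' y = inv (blinfun_apply (F' (g y)))"
    using inverse_function_theorem[of W F F' x0 "Blinfun ((*v) (matrix_inv (A x0)))"] by metis
  show thesis
  proof (rule that[OF IFT(3,4)])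
    show "g (F x0) = x0" using IFT(2,5) by (simp add: homeomorphism_def)
    show "F (g y) = y" if "y \<in> V" for y using IFT(5) that by (simp add: homeomorphism_def)
    show det: "det (A (g y)) \<noteq> 0" if "y \<in> V" for y
      using IFT(1,5) that by (auto simp: homeomorphism_def W_def)
    show "(g has_derivative (*v) (matrix_inv (A (g y)))) (at y)" if "y \<in> V" for y
    proof -
      have "inv ((*v) (A (g y))) = (*v) (matrix_inv (A (g y)))"
        by (intro inv_equality) (simp_all add: matrix_inv_vector_mult det[OF that])
      then show ?thesis using IFT(6,7)[OF that] by (simp add: apply_F')
    qed
  qed
qed

locale polynomial_coordinates =
  fixes a :: "'n \<Rightarrow> complex^'n \<Rightarrow> complex" and x0 :: "complex^'n"
  assumes polyfun_coordinate: "a i \<in> polyfun coordsV"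
    and nonsingular: "det (jacobian a x0) \<noteq> 0"
begin

lemma polyfun_jacobian: "(\<lambda>x. jacobian a x $ i $ j) \<in> polyfun coordsV"
  using polymap_gradient[OF polyfun_coordinate] by (simp add: polymap_def)

lemma polyfun_det_jacobian: "(\<lambda>x. det (jacobian a x)) \<in> polyfun coordsV"
  by (intro polyfun_det polyfun_jacobian)

text \<open>One factor \<open>det (jacobian a x)\<close> clears the denominators of the inverse matrix, the second
  makes the field vanish where the coordinates degenerate and \<open>matrix_inv\<close> is meaningless.\<close>

definition coordinate_field :: "'n \<Rightarrow> complex^'n \<Rightarrow> complex^'n" where
  "coordinate_field p x = (det (jacobian a x))\<^sup>2 *s (matrix_inv (jacobian a x) *v axis p 1)"

lemma polymap_coordinate_field: "coordinate_field p \<in> polymap coordsV"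
proof -
  have "coordinate_field p x $ k =
      det (jacobian a x) * det (\<chi> i j. if j = k then axis p 1 $ i else jacobian a x $ i $ j)"
    for x k
  proof (cases "det (jacobian a x) = 0")
    case True
    then show ?thesis by (simp add: coordinate_field_def)
  next
    case False
    then show ?thesis
      using cramer_lemma[of k "jacobian a x" "matrix_inv (jacobian a x) *v axis p 1",
          unfolded matrix_inv_vector_mult(1)[OF False]]
      by (simp add: coordinate_field_def power2_eq_square)
  qed
  moreover have "(\<lambda>x. if j = k then axis p 1 $ i else jacobian a x $ i $ j) \<in> polyfun coordsV"
    for i j k
    using polyfun_jacobian[of i j] by (cases "j = k") (simp_all add: pf_const)
  ultimately show ?thesis
    by (auto simp: polymap_def intro!: pf_mult polyfun_det_jacobian polyfun_det)
qed

abbreviation coordinate_arc :: "'n \<Rightarrow> complex set \<Rightarrow> (complex \<Rightarrow> complex^'n) \<Rightarrow> bool" where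
  "coordinate_arc p \<equiv> integral_arc (coordinate_field p) (\<lambda>x. (det (jacobian a x))\<^sup>2)"

lemma bdot_coordinate_field_gradient:
  "bdot (coordinate_field p x) (gradient (a i) x) = (if i = p then (det (jacobian a x))\<^sup>2 else 0)"
proof (cases "det (jacobian a x) = 0")
  case True
  then show ?thesis by (simp add: coordinate_field_def bdot.zero_left)
next
  case False
  then have "jacobian a x *v coordinate_field p x = (det (jacobian a x))\<^sup>2 *s axis p 1"
    by (simp add: coordinate_field_def vec.scale matrix_inv_vector_mult)
  from arg_cong[OF this, of "\<lambda>y. y $ i"] show ?thesis
    by (simp add: matrix_vector_mult_component_bdot bdot_commute axis_def)
qed

lemma local_inverse_exists:
  defines "F \<equiv> \<lambda>x. \<chi> i. a i x"
  obtains V g where "open V" "F x0 \<in> V" "g (F x0) = x0"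
    "\<And>y. y \<in> V \<Longrightarrow> F (g y) = y" "\<And>y. y \<in> V \<Longrightarrow> det (jacobian a (g y)) \<noteq> 0"
    "\<And>y. y \<in> V \<Longrightarrow> (g has_derivative (*v) (matrix_inv (jacobian a (g y)))) (at y)"
proof -
  have deriv: "(F has_derivative (*v) (jacobian a x)) (at x)" for x
    using has_derivative_vec_lambda[OF polyfun_has_derivative[OF polyfun_coordinate], of "\<lambda>i. i" x]
    by (simp add: F_def matrix_vector_mult_def[abs_def] bdot_def[abs_def])
  have cont: "continuous_on UNIV (\<lambda>x. jacobian a x $ i $ j)" for i j
    using polymap_gradient[OF polyfun_coordinate]
    by (simp add: continuous_on_component continuous_on_polymap)
  show thesis
    by (rule inverse_function_theorem_matrix[of UNIV x0 F "jacobian a",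
          OF open_UNIV UNIV_I deriv cont nonsingular]) (rule that)
qed

lemma coordinate_arc_exists:
  obtains \<epsilon> \<gamma> where "\<epsilon> > 0" "\<gamma> 0 = x0" "coordinate_arc p (ball 0 \<epsilon>) \<gamma>"
    "\<And>i. a i constant_on \<gamma> ` ball 0 \<epsilon> \<longleftrightarrow> i \<noteq> p"
proof -
  define F where "F x = (\<chi> i. a i x)" for x
  obtain V g where g: "open V" "F x0 \<in> V" "g (F x0) = x0"
      "\<And>y. y \<in> V \<Longrightarrow> F (g y) = y" "\<And>y. y \<in> V \<Longrightarrow> det (jacobian a (g y)) \<noteq> 0"
      "\<And>y. y \<in> V \<Longrightarrow> (g has_derivative (*v) (matrix_inv (jacobian a (g y)))) (at y)"
    by (rule local_inverse_exists[folded F_def]) (rule that)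
  define line where "line t = F x0 + t *s axis p 1" for t
  have line: "(line has_derivative (\<lambda>h. h *s axis p 1)) (at t)" for t
    unfolding line_def by (rule has_derivative_complex_line)
  then have "open (line -` V)"
    by (meson open_vimage[OF g(1)] has_derivative_continuous continuous_at_imp_continuous_on)
  moreover have "0 \<in> line -` V" using g(2) by (simp add: line_def)
  ultimately obtain \<epsilon> where \<epsilon>: "\<epsilon> > 0" "\<And>t. t \<in> ball 0 \<epsilon> \<Longrightarrow> line t \<in> V"
    unfolding open_contains_ball by blast
  define \<gamma> where "\<gamma> t = g (line t)" for t
  have coords: "a i (\<gamma> t) = a i x0 + (if i = p then t else 0)" if "t \<in> ball 0 \<epsilon>" for i t
    using arg_cong[OF g(4)[OF \<epsilon>(2)[OF that]], of "\<lambda>y. y $ i"]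
    by (simp add: \<gamma>_def F_def line_def axis_def)
  show thesis
  proof (rule that[of \<epsilon> \<gamma>])
    have "(\<gamma> has_derivative (\<lambda>h. h *s (matrix_inv (jacobian a (\<gamma> t)) *v axis p 1))) (at t)"
      if "t \<in> ball 0 \<epsilon>" for t
      using has_derivative_compose[OF line g(6)[OF \<epsilon>(2)[OF that]]]
      by (simp add: vec.scale \<gamma>_def[abs_def])
    then show "coordinate_arc p (ball 0 \<epsilon>) \<gamma>"
      using g(5)[OF \<epsilon>(2)] by (simp add: integral_arc_def coordinate_field_def \<gamma>_def)
    have ends: "0 \<in> ball (0::complex) \<epsilon>" "complex_of_real (\<epsilon> / 2) \<in> ball 0 \<epsilon>"
      using \<epsilon>(1) by simp_all
    have "a p (\<gamma> 0) \<noteq> a p (\<gamma> (complex_of_real (\<epsilon> / 2)))"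
      unfolding coords[OF ends(1)] coords[OF ends(2)] using \<epsilon>(1) by simp
    then have "\<not> a p constant_on \<gamma> ` ball 0 \<epsilon>"
      using ends unfolding constant_on_def by (metis imageI)
    moreover have "a i constant_on \<gamma> ` ball 0 \<epsilon>" if "i \<noteq> p" for i
      using coords that by (simp add: constant_on_def)
    ultimately show "a i constant_on \<gamma> ` ball 0 \<epsilon> \<longleftrightarrow> i \<noteq> p" for i
      by blast
  qed (use \<epsilon>(1) g(3) in \<open>simp_all add: \<gamma>_def line_def\<close>)
qed

text \<open>Stands in for Nakayama's lemma: where the difference quotients of the coordinates at \<open>x0\<close>
  remain independent, no point other than \<open>x0\<close> has the same coordinates.\<close>

lemma irreducible_common_level_eq_singleton:
  assumes X: "zariski_irreducible coordsV X" "x0 \<in> X"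
    and level: "\<And>i x. x \<in> X \<Longrightarrow> a i x = a i x0"
  shows "X = {x0}"
proof -
  have "\<exists>B. difference_quotient (a i) B" for i
    using polyfun_difference_quotient_exists[OF polyfun_coordinate] by blast
  then obtain B where B: "\<And>i. difference_quotient (a i) (B i)" by metis
  define M where "M x = (\<chi> i. B i (x, x0))" for x
  have det_poly: "(\<lambda>x. det (M x)) \<in> polyfun coordsV"
    using B polymap_compose_coordsP[of "B i" for i, OF _ polymap_id polymap_const]
    by (intro polyfun_det) (simp add: M_def difference_quotient_def polymap_def)
  have "x = x0" if "x \<in> X" "det (M x) \<noteq> 0" for x
  proof -
    have "bdot (B i (x, x0)) (x - x0) = a i x - a i x0" for i
      using B[of i] by (simp add: difference_quotient_def)
    then have "M x *v (x - x0) = 0"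
      using level[OF that(1)] by (simp add: M_def vec_eq_iff matrix_vector_mult_component_bdot)
    then show "x = x0"
      using matrix_inv_vector_mult(2)[OF that(2), of "x - x0"] by simp
  qed
  then have "X \<subseteq> {x0} \<union> {x. det (M x) = 0}" by blast
  from zariski_irreducible_subset_Un[OF X(1) zariski_closed_singleton
      zariski_closed_level[OF det_poly] this]
  have "X \<subseteq> {x0} \<or> X \<subseteq> {x. det (M x) = 0}" .
  moreover have "M x0 = jacobian a x0"
    by (simp add: M_def vec_eq_iff gradient_difference_quotient[OF B])
  ultimately show ?thesis
    using X(2) nonsingular by auto
qed

end

section \<open>A dense regular arc on a curve\<close>

locale adapted_frame = polynomial_coordinates a x0
  for a :: "'n \<Rightarrow> complex^'n \<Rightarrow> complex" and x0 :: "complex^'n" +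
  fixes X :: "(complex^'n) set" and J :: "'n set"
  assumes closed: "zariski_closed coordsV X"
    and base_point: "x0 \<in> X"
    and coordinate_vanishes: "i \<in> J \<Longrightarrow> a i \<in> vanishing_ideal coordsV X"
    and dim_normal_space_le: "x \<in> X \<Longrightarrow> vec.dim (normal_space_at X x) \<le> card J"
begin

lemma normal_space_eq_span:
  assumes "x \<in> X" "det (jacobian a x) \<noteq> 0"
  shows "normal_space_at X x = vec.span ((\<lambda>i. gradient (a i) x) ` J)"
    and "vec.dim (normal_space_at X x) = card J"
proof -
  let ?B = "(\<lambda>i. gradient (a i) x) ` J"
  have rows: "($) (jacobian a x) = (\<lambda>i. gradient (a i) x)"
    by (simp add: fun_eq_iff)
  have indep: "vec.independent ?B"
    by (rule vec.independent_mono[OF independent_rows_if_det_nz[OF assms(2), unfolded rows]]) auto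
  have sub: "?B \<subseteq> normal_space_at X x"
    using coordinate_vanishes gradient_in_normal_space by blast
  have "card ?B = card J"
    using inj_rows_if_det_nz[OF assms(2), unfolded rows] by (auto intro: card_image inj_on_subset)
  then have span: "normal_space_at X x \<subseteq> vec.span ?B" and "vec.dim (normal_space_at X x) = card J"
    using vec.card_ge_dim_independent[OF sub indep] vec.independent_card_le_dim[OF sub indep]
      dim_normal_space_le[OF assms(1)] by simp_all
  then show "vec.dim (normal_space_at X x) = card J" by simp
  have "vec.span ?B \<subseteq> normal_space_at X x"
    using vec.span_mono[OF sub] by (simp add: normal_space_at_def vec.span_span)
  with span show "normal_space_at X x = vec.span ?B" by blast
qed

lemma tangent_coordinate_field:
  assumes "p \<notin> J"
  shows "tangent_field X (coordinate_field p)"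
proof -
  have "bdot (coordinate_field p x) y = 0" if "x \<in> X" "y \<in> normal_space_at X x" for x y
  proof (cases "det (jacobian a x) = 0")
    case True
    then show ?thesis by (simp add: coordinate_field_def bdot.zero_left)
  next
    case False
    then have "y \<in> vec.span ((\<lambda>i. gradient (a i) x) ` J)"
      using normal_space_eq_span(1) that by blast
    then show ?thesis
      by (rule bdot_span_eq_0) (use assms in \<open>auto simp: bdot_coordinate_field_gradient\<close>)
  qed
  then show ?thesis by (simp add: tangent_field_def polymap_coordinate_field)
qed

lemma irreducible_curve_frame_not_full:
  assumes "irreducible_curve X"
  shows "J \<noteq> UNIV"
proof
  assume "J = UNIV"
  then have "a i x = a i x0" if "x \<in> X" for i x
    using coordinate_vanishes[of i] base_point that by (simp add: vanishing_ideal_def)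
  then have "X = {x0}"
    by (intro irreducible_common_level_eq_singleton irreducible_curve_irreducible[OF assms]
        base_point)
  then show False using irreducible_curve_not_singleton[OF assms] by blast
qed

lemma coordinate_arc_dense:
  assumes curve: "irreducible_curve X" and p: "p \<notin> J"
  obtains \<epsilon> \<gamma> where
    "coordinate_arc p (ball 0 \<epsilon>) \<gamma>"
    "\<gamma> ` ball 0 \<epsilon> \<subseteq> X" "zariski_closure coordsV (\<gamma> ` ball 0 \<epsilon>) = X"
    "\<And>i. a i constant_on \<gamma> ` ball 0 \<epsilon> \<longleftrightarrow> i \<noteq> p"
proof -
  obtain \<epsilon> \<gamma> where \<epsilon>: "\<epsilon> > 0" and \<gamma>0: "\<gamma> 0 = x0"
    and arc: "coordinate_arc p (ball 0 \<epsilon>) \<gamma>"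
    and coords: "\<And>i. a i constant_on \<gamma> ` ball 0 \<epsilon> \<longleftrightarrow> i \<noteq> p"
    using coordinate_arc_exists[of p] by blast
  let ?S = "\<gamma> ` ball 0 \<epsilon>" and ?Z = "zariski_closure coordsV (\<gamma> ` ball 0 \<epsilon>)"
  have "(\<lambda>x. (det (jacobian a x))\<^sup>2) \<in> polyfun coordsV"
    unfolding power2_eq_square by (intro pf_mult polyfun_det_jacobian)
  then have sub: "?S \<subseteq> X"
    using integral_arc_subset_variety[OF closed tangent_coordinate_field[OF p] _ arc, of 0]
      \<epsilon> \<gamma>0 base_point by simp
  have "(\<lambda>t. \<gamma> t $ i) holomorphic_on ball 0 \<epsilon>" for i
    by (rule integral_arc_holomorphic[OF arc polyfun_component open_ball])
  then have irr: "zariski_irreducible coordsV ?Z"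
    using \<epsilon> by (intro zariski_irreducible_closure_holomorphic_image) auto
  have "x0 \<in> ?S" using \<gamma>0 \<epsilon> by (auto intro: image_eqI[of _ _ 0])
  moreover have "\<not> ?S \<subseteq> {x0}"
    using coords[of p] unfolding constant_on_def by (metis singletonD subsetD)
  ultimately have "{x0} \<subset> ?Z"
    using zariski_closure_superset[of ?S coordsV] by blast
  then have "?Z = X"
    using irreducible_curve_eq_if_chain[OF curve zariski_irreducible_singleton irr]
      zariski_closure_minimal[OF closed sub] by blast
  then show thesis using that arc sub coords by blast
qed

lemma coordinate_constant_on_curve_iff:
  assumes "irreducible_curve X" "p \<notin> J"
  shows "a i constant_on X \<longleftrightarrow> i \<noteq> p"
proof -
  obtain \<epsilon> and \<gamma> :: "complex \<Rightarrow> complex^'n"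
    where sub: "\<gamma> ` ball 0 \<epsilon> \<subseteq> X" and dense: "zariski_closure coordsV (\<gamma> ` ball 0 \<epsilon>) = X"
      and const: "a i constant_on \<gamma> ` ball 0 \<epsilon> \<longleftrightarrow> i \<noteq> p"
    by (rule coordinate_arc_dense[OF assms]) blast
  have "a i constant_on X \<longleftrightarrow> a i constant_on \<gamma> ` ball 0 \<epsilon>"
    using constant_on_zariski_closure[OF polyfun_coordinate, of i "\<gamma> ` ball 0 \<epsilon>"]
      constant_on_subset[OF _ sub] unfolding dense by blast
  with const show ?thesis by simp
qed

lemma irreducible_curve_frame_corank_1:
  assumes curve: "irreducible_curve X"
  shows "card J = CARD('n) - 1"
proof -
  obtain p where p: "p \<notin> J" using irreducible_curve_frame_not_full[OF curve] by blast
  have "q = p" if "q \<notin> J" for q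
    using coordinate_constant_on_curve_iff[OF curve p, of q]
      coordinate_constant_on_curve_iff[OF curve that, of q] by blast
  then have "J = UNIV - {p}" using p by blast
  then show ?thesis by (simp add: card_Diff_singleton)
qed

lemma regular_point_if_nonsingular:
  assumes "irreducible_curve X" "x \<in> X" "det (jacobian a x) \<noteq> 0"
  shows "x \<in> regular_points X"
  using assms normal_space_eq_span(2)[OF assms(2,3)] irreducible_curve_frame_corank_1
  by (simp add: regular_points_def alg_dim_irreducible_curve)

end

lemma normal_space_max_dim_point_exists:
  fixes X :: "(complex^'n) set"
  assumes "X \<noteq> {}"
  obtains x where "x \<in> X"
    "\<And>y. y \<in> X \<Longrightarrow> vec.dim (normal_space_at X y) \<le> vec.dim (normal_space_at X x)"
proof -
  obtain y where "y \<in> X" using assms by blast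
  moreover have "\<forall>x. x \<in> X \<longrightarrow> vec.dim (normal_space_at X x) < Suc CARD('n)"
    by (metis vec.dim_subset subset_UNIV vec_dim_card le_imp_less_Suc)
  ultimately show thesis
    using that ex_has_greatest_nat[of "\<lambda>x. x \<in> X" y "\<lambda>x. vec.dim (normal_space_at X x)"] by blast
qed

lemma adapted_frame_exists:
  fixes X :: "(complex^'n) set"
  assumes "zariski_closed coordsV X" "X \<noteq> {}"
  obtains a x0 J where "adapted_frame a x0 X J"
proof -
  obtain x0 where x0: "x0 \<in> X"
      "\<And>y. y \<in> X \<Longrightarrow> vec.dim (normal_space_at X y) \<le> vec.dim (normal_space_at X x0)"
    by (rule normal_space_max_dim_point_exists[OF assms(2)]) (rule that)
  let ?G = "(\<lambda>f. gradient f x0) ` vanishing_ideal coordsV X"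
  obtain B where B: "B \<subseteq> ?G" "vec.independent B" "card B = vec.dim ?G"
    using vec.basis_exists[of ?G] by metis
  obtain A :: "complex^'n^'n" and J where A: "det A \<noteq> 0" "bij_betw (($) A) J B"
    using extend_independent_to_nonsingular_matrix[OF B(2)] .
  have "\<exists>f. f \<in> polyfun coordsV \<and> gradient f x0 = A $ i \<and>
      (i \<in> J \<longrightarrow> f \<in> vanishing_ideal coordsV X)" for i
  proof (cases "i \<in> J")
    case True
    then have "A $ i \<in> ?G" using A(2) B(1) by (auto simp: bij_betw_def)
    then show ?thesis by (auto simp: vanishing_ideal_def)
  next
    case False
    moreover have "bdot (A $ i) \<in> polyfun coordsV"
      by (intro polyfun_bdot[of "\<lambda>_. A $ i" _ "\<lambda>x. x", simplified] polymap_const polymap_id)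
    ultimately show ?thesis using gradient_bdot by blast
  qed
  then obtain a where a: "\<And>i. a i \<in> polyfun coordsV" "\<And>i. gradient (a i) x0 = A $ i"
      "\<And>i. i \<in> J \<Longrightarrow> a i \<in> vanishing_ideal coordsV X"
    by metis
  have "card J = vec.dim (normal_space_at X x0)"
    using bij_betw_same_card[OF A(2)] B(3) by (simp add: normal_space_at_def)
  moreover have "jacobian a x0 = A" by (simp add: vec_eq_iff a(2))
  ultimately have "adapted_frame a x0 X J"
    using assms(1) x0 a A(1) by unfold_locales auto
  then show thesis by (rule that)
qed

lemma irreducible_curve_dense_regular_arc:
  fixes X :: "(complex^'n) set"
  assumes curve: "irreducible_curve X"
  obtains v q \<epsilon> \<gamma> where "tangent_field X v" "integral_arc v q (ball 0 \<epsilon>) \<gamma>"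
    "\<gamma> ` ball 0 \<epsilon> \<subseteq> regular_points X" "zariski_closure coordsV (\<gamma> ` ball 0 \<epsilon>) = X"
proof -
  have "X \<noteq> {}" using curve by (simp add: irreducible_curve_def zariski_irreducible_def)
  then obtain a x0 J where "adapted_frame a x0 X J"
    using adapted_frame_exists[OF irreducible_curve_closed[OF curve]] by blast
  then interpret adapted_frame a x0 X J .
  obtain p where p: "p \<notin> J" using irreducible_curve_frame_not_full[OF curve] by blast
  obtain \<epsilon> \<gamma> where arc: "coordinate_arc p (ball 0 \<epsilon>) \<gamma>"
      "\<gamma> ` ball 0 \<epsilon> \<subseteq> X" "zariski_closure coordsV (\<gamma> ` ball 0 \<epsilon>) = X"
    by (rule coordinate_arc_dense[OF curve p]) blast
  then have "\<gamma> ` ball 0 \<epsilon> \<subseteq> regular_points X"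
    using regular_point_if_nonsingular[OF curve] by (auto simp: integral_arc_def)
  then show thesis using that tangent_coordinate_field[OF p] arc(1,3) by blast
qed

section \<open>The ED correspondence of a curve\<close>

lemma zariski_closed_ED_fiber: "zariski_closed coordsV (ED_fiber X u)"
proof -
  have "(\<lambda>x. c (x, u)) \<in> polyfun coordsV" if "c \<in> coordsP" for c
    using that by (auto simp: coordsP_def coordsV_def intro: pf_const pf_coord)
  then have "zariski_closed coordsV ((\<lambda>x. (x, u)) -` ED_corr X)"
    unfolding ED_corr_def by (rule zariski_closed_vimage[OF zariski_closed_closure])
  moreover have "ED_fiber X u = (\<lambda>x. (x, u)) -` ED_corr X" by (auto simp: ED_fiber_def)
  ultimately show ?thesis by simp
qed

lemma ED_fiber_subset:
  fixes X :: "(complex^'n) set"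
  assumes "zariski_closed coordsV X"
  shows "ED_fiber X u \<subseteq> X"
proof -
  have "(\<lambda>z. c (fst z)) \<in> polyfun coordsP" if "c \<in> coordsV" for c :: "complex^'n \<Rightarrow> complex"
    using that by (auto simp: coordsP_def coordsV_def intro: pf_coord)
  then have "zariski_closed coordsP (fst -` X)"
    by (rule zariski_closed_vimage[OF assms])
  then have "ED_corr X \<subseteq> fst -` X"
    unfolding ED_corr_def by (rule zariski_closure_minimal) (auto simp: regular_points_def)
  then show ?thesis by (auto simp: ED_fiber_def)
qed

lemma Sigma_inf_curve_iff:
  assumes curve: "irreducible_curve X"
  shows "u \<in> Sigma_inf X \<longleftrightarrow> X \<subseteq> ED_fiber X u"
proof
  assume "u \<in> Sigma_inf X"
  then obtain A B where AB: "zariski_irreducible coordsV A" "zariski_irreducible coordsV B"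
      "A \<subset> B" "B \<subseteq> ED_fiber X u"
    unfolding Sigma_inf_def mem_Collect_eq dim_ge_1_iff by blast
  then have "B = X"
    using irreducible_curve_eq_if_chain[OF curve AB(1-3)]
      ED_fiber_subset[OF irreducible_curve_closed[OF curve]] by blast
  with AB(4) show "X \<subseteq> ED_fiber X u" by simp
next
  assume "X \<subseteq> ED_fiber X u"
  then show "u \<in> Sigma_inf X"
    using curve dim_ge_mono[of coordsV X 1] by (simp add: Sigma_inf_def irreducible_curve_def)
qed

lemma ED_fiber_orthogonal_tangent_field:
  assumes v: "tangent_field X v" and "x \<in> ED_fiber X u"
  shows "bdot (v x) (u - x) = 0"
proof -
  let ?P = "\<lambda>z. bdot (v (fst z)) (snd z - fst z)"
  have "(\<lambda>z. v (fst z)) \<in> polymap coordsP"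
    using v by (intro polymap_compose_coordsV[OF _ polymap_fst]) (simp add: tangent_field_def)
  then have "?P \<in> polyfun coordsP"
    by (intro polyfun_bdot polymap_diff polymap_fst polymap_snd)
  from zariski_closed_level[OF this] have "ED_corr X \<subseteq> {z. ?P z = 0}"
    unfolding ED_corr_def
    by (rule zariski_closure_minimal) (use v in \<open>auto simp: regular_points_def tangent_field_def\<close>)
  then show ?thesis using assms(2) by (auto simp: ED_fiber_def)
qed

lemma gradient_in_normal_space_if_constant:
  assumes "f \<in> polyfun coordsV" "f constant_on X"
  shows "gradient f x \<in> normal_space_at X x"
proof -
  obtain c where "\<forall>x\<in>X. f x = c" using assms(2) by (auto simp: constant_on_def)
  then have "(\<lambda>x. f x - c) \<in> vanishing_ideal coordsV X"
    by (simp add: vanishing_ideal_def polyfun_diff pf_const assms(1))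
  moreover have "gradient (\<lambda>x. f x - c) x = gradient f x"
    using polyfun_has_derivative[OF assms(1), of x]
    by (intro gradient_eqI) (auto intro!: derivative_eq_intros)
  ultimately show ?thesis using gradient_in_normal_space by metis
qed

lemma radius_in_normal_space:
  assumes "sq_dist u constant_on X"
  shows "u - x \<in> normal_space_at X x"
proof -
  have "(- 1 / 2) *s (2 *s (x - u)) \<in> normal_space_at X x"
    using gradient_in_normal_space_if_constant[OF polyfun_sq_dist assms, of x]
    unfolding gradient_sq_dist normal_space_at_def by (rule vec.span_scale)
  moreover have "(- 1 / 2) *s (2 *s (x - u)) = u - x" by (simp add: vec_eq_iff)
  ultimately show ?thesis by metis
qed

proposition Sigma_inf_curve_eq_centers:
  assumes curve: "irreducible_curve X"
  shows "Sigma_inf X = {u. sq_dist u constant_on X}"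
proof (intro set_eqI iffI; simp only: mem_Collect_eq)
  obtain v q \<epsilon> \<gamma> where v: "tangent_field X v" and arc: "integral_arc v q (ball 0 \<epsilon>) \<gamma>"
      and regular: "\<gamma> ` ball 0 \<epsilon> \<subseteq> regular_points X"
      and dense: "zariski_closure coordsV (\<gamma> ` ball 0 \<epsilon>) = X"
    using irreducible_curve_dense_regular_arc[OF curve] .
  fix u
  show "sq_dist u constant_on X" if u: "u \<in> Sigma_inf X"
  proof -
    have "bdot (v (\<gamma> t)) (gradient (sq_dist u) (\<gamma> t)) = 0" if "t \<in> ball 0 \<epsilon>" for t
    proof -
      have "\<gamma> t \<in> X" using regular that unfolding regular_points_def by blast
      then have "\<gamma> t \<in> ED_fiber X u" using u Sigma_inf_curve_iff[OF curve] by blast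
      from ED_fiber_orthogonal_tangent_field[OF v this] show ?thesis
        by (simp only: gradient_sq_dist bdot_scale_right bdot.diff_right) simp
    qed
    then have "sq_dist u constant_on \<gamma> ` ball 0 \<epsilon>"
      by (intro constant_on_integral_arc[OF arc polyfun_sq_dist connected_ball open_ball])
    then show ?thesis
      using constant_on_zariski_closure[OF polyfun_sq_dist] dense by metis
  qed
  show "u \<in> Sigma_inf X" if u: "sq_dist u constant_on X"
  proof -
    have "(x, u) \<in> ED_corr X" if "x \<in> regular_points X" for x
      unfolding ED_corr_def using that radius_in_normal_space[OF u]
      by (intro subsetD[OF zariski_closure_superset]) simp
    then have "\<gamma> ` ball 0 \<epsilon> \<subseteq> ED_fiber X u" using regular by (auto simp: ED_fiber_def)
    from zariski_closure_minimal[OF zariski_closed_ED_fiber this] show ?thesis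
      by (simp add: dense Sigma_inf_curve_iff[OF curve])
  qed
qed

section \<open>Centers of hyperspheres containing a set\<close>

lemma subset_hypersphere_iff: "(\<exists>r. X \<subseteq> hypersphere u r) \<longleftrightarrow> sq_dist u constant_on X"
  by (auto simp: hypersphere_def sq_dist_def constant_on_def)

lemma complex_affine_bdot_level: "complex_affine {x. bdot y x = s}"
proof (cases "\<exists>p. bdot y p = s")
  case True
  then obtain p where p: "bdot y p = s" by blast
  have "{x. bdot y x = s} = (\<lambda>w. p + w) ` {w. bdot y w = 0}"
  proof (intro equalityI subsetI)
    fix x assume "x \<in> {x. bdot y x = s}"
    then have "x - p \<in> {w. bdot y w = 0}" by (simp add: bdot.diff_right p)
    then show "x \<in> (\<lambda>w. p + w) ` {w. bdot y w = 0}" by (rule rev_image_eqI) simp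
  qed (auto simp: bdot.add_right p)
  then show ?thesis
    unfolding complex_affine_def using subspace_bdot_kernel by blast
qed (auto simp: complex_affine_def)

lemma normal_space_affine_hull_iff:
  "y \<in> normal_space_affine (complex_affine_hull X) \<longleftrightarrow> bdot y constant_on X"
proof
  assume "y \<in> normal_space_affine (complex_affine_hull X)"
  moreover have "X \<subseteq> complex_affine_hull X" by (auto simp: complex_affine_hull_def)
  ultimately have "\<forall>x\<in>X. \<forall>x'\<in>X. bdot y x = bdot y x'"
    by (auto simp: normal_space_affine_def bdot.diff_right subset_iff)
  then show "bdot y constant_on X" unfolding constant_on_def by metis
next
  assume "bdot y constant_on X"
  then obtain s where "X \<subseteq> {x. bdot y x = s}" by (auto simp: constant_on_def)
  then have "complex_affine_hull X \<subseteq> {x. bdot y x = s}"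
    unfolding complex_affine_hull_def using complex_affine_bdot_level by blast
  then show "y \<in> normal_space_affine (complex_affine_hull X)"
    by (auto simp: normal_space_affine_def bdot.diff_right subset_iff)
qed

lemma sq_dist_translate:
  "sq_dist (c + y) x = sq_dist c x - 2 * bdot y x + (2 * bdot y c + bdot y y)"
proof -
  have "bdot (d - y) (d - y) = bdot d d - 2 * bdot y d + bdot y y" for d
    by (simp add: bdot.diff_left bdot.diff_right bdot_commute[of d y])
  from this[of "x - c"] show ?thesis
    by (simp add: sq_dist_def diff_diff_eq bdot.diff_right)
qed

lemma translated_center_iff:
  assumes "sq_dist c constant_on X"
  shows "sq_dist (c + y) constant_on X \<longleftrightarrow> bdot y constant_on X"
proof -
  obtain r where r: "\<And>x. x \<in> X \<Longrightarrow> sq_dist c x = r"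
    using assms by (auto simp: constant_on_def)
  have "sq_dist (c + y) x = s \<longleftrightarrow> bdot y x = (r + 2 * bdot y c + bdot y y - s) / 2"
    if "x \<in> X" for x s
    by (auto simp: sq_dist_translate r[OF that] field_simps)
  moreover have "bdot y x = s \<longleftrightarrow> sq_dist (c + y) x = r - 2 * s + (2 * bdot y c + bdot y y)"
    if "x \<in> X" for x s
    by (simp add: sq_dist_translate r[OF that])
  ultimately show ?thesis unfolding constant_on_def by metis
qed

theorem mainTheorem13:
  fixes X :: "(complex^'n) set"
  assumes "irreducible_curve X"
  shows "((\<forall>c r. \<not> X \<subseteq> hypersphere c r) \<longrightarrow> Sigma_inf X = {})
       \<and> (\<forall>c r. X \<subseteq> hypersphere c r \<longrightarrow>
            Sigma_inf X = {c + y | y. y \<in> normal_space_affine (complex_affine_hull X)})"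
proof (intro conjI impI allI)
  have centers: "Sigma_inf X = {u. sq_dist u constant_on X}"
    by (rule Sigma_inf_curve_eq_centers[OF assms])
  show "Sigma_inf X = {}" if "\<forall>c r. \<not> X \<subseteq> hypersphere c r"
    using that by (simp add: centers flip: subset_hypersphere_iff)
  fix c r assume "X \<subseteq> hypersphere c r"
  then have c: "sq_dist c constant_on X" using subset_hypersphere_iff by blast
  have "u \<in> Sigma_inf X \<longleftrightarrow> (\<exists>y. u = c + y \<and> sq_dist (c + y) constant_on X)" for u
    by (metis centers diff_add_cancel add.commute mem_Collect_eq)
  then show "Sigma_inf X = {c + y | y. y \<in> normal_space_affine (complex_affine_hull X)}"
    by (auto simp: normal_space_affine_hull_iff translated_center_iff[OF c])
qed

end
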